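(* Let $\mathcal{H}_S$ be a finite-dimensional Hilbert space carrying a unitary representation $\pi$ of $\mathrm{SU}(d)$, let $\mathcal{B}(\mathcal{H}_S)$ be the space of linear operators on $\mathcal{H}_S$ with the induced conjugation action of $\mathrm{SU}(d)$, and let $\mathcal{I}_S\subseteq\mathcal{B}(\mathcal{H}_S)$ be a linear subspace (the interaction subspace). Let $\mathcal{G}<\mathrm{SU}(d)$ be a finite subgroup, and suppose there exists a linear subspace $V$ with $\mathcal{I}_S\subseteq V\subseteq\mathcal{B}(\mathcal{H}_S)$ that is invariant under the action of $\mathcal{G}$, i.e. $\pi(g)^\dagger S\,\pi(g)\in V$ for all $S\in V$ and all $g\in\mathcal{G}$. If $\mathcal{G}$ is an inaccessible symmetry for $V$, then $\mathcal{G}$ is a decoupling group for $\mathcal{I}_S$.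
   Context: For a finite subgroup $\mathcal{G}<\mathrm{SU}(d)$ put $\Pi_{\mathcal{G}}(S)=\frac{1}{|\mathcal{G}|}\sum_{g\in\mathcal{G}}\pi(g^{-1})\,S\,\pi(g)$ for $S\in\mathcal{B}(\mathcal{H}_S)$. The $\mathcal{G}$-invariant subspace of $V$ is the set of elements of $V$ fixed by conjugation by every $\pi(g)$, $g\in\mathcal{G}$. Inaccessible symmetry: $\mathcal{G}$ is an inaccessible symmetry for a space of operators $V$ (closed under conjugation by $\pi(\mathcal{G})$) if the $\mathcal{G}$-invariant subspace of $V$ is either $\{0\}$ or the span of the identity operator. Interaction subspace: for a system-bath Hamiltonian $H=\sum_\alpha S_\alpha\otimes B_\alpha$, $\mathcal{I}_S=\mathrm{span}\{S_\alpha\}_\alpha$; for the present statement it is an arbitrary linear subspace of $\mathcal{B}(\mathcal{H}_S)$. Decoupling group: $\mathcal{G}$ is a decoupling group for $\mathcal{I}_S$ if the image $\Pi_{\mathcal{G}}(\mathcal{I}_S)$ is $\{0\}$ or the span of the identity operator. *)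

theory Defs
  imports "HOL-Analysis.Analysis" "HOL-Library.Function_Algebras" "HOL-Algebra.Group"
begin

text \<open>A finite-dimensional complex Hilbert space; the inner product is antilinear in its first
  argument. Completeness is automatic in finite dimension.\<close>

locale fin_dim_hilbert_space = vector_space smul
  for smul :: "complex \<Rightarrow> 'h::ab_group_add \<Rightarrow> 'h" +
  fixes cinner :: "'h \<Rightarrow> 'h \<Rightarrow> complex"
  assumes finite_dim: "\<exists>B. finite B \<and> span B = UNIV"
    and cinner_add_right: "cinner x (y + z) = cinner x y + cinner x z"
    and cinner_scale_right: "cinner x (smul c y) = c * cinner x y"
    and cinner_commute: "cinner x y = cnj (cinner y x)"
    and cinner_pos: "x \<noteq> 0 \<Longrightarrow> 0 < Re (cinner x x)"

definition operators :: "(complex \<Rightarrow> 'h::ab_group_add \<Rightarrow> 'h) \<Rightarrow> ('h \<Rightarrow> 'h) set" where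
  "operators smul = {S. Vector_Spaces.linear smul smul S}"

definition op_scale :: "(complex \<Rightarrow> 'h \<Rightarrow> 'h) \<Rightarrow> complex \<Rightarrow> ('h \<Rightarrow> 'h) \<Rightarrow> 'h \<Rightarrow> 'h" where
  "op_scale smul c S = (\<lambda>x. smul c (S x))"

definition op_adjoint :: "('h \<Rightarrow> 'h \<Rightarrow> complex) \<Rightarrow> ('h \<Rightarrow> 'h) \<Rightarrow> 'h \<Rightarrow> 'h" where
  "op_adjoint cinner S = (THE T. \<forall>x y. cinner (T x) y = cinner x (S y))"

definition unitary_group ::
  "(complex \<Rightarrow> 'h::ab_group_add \<Rightarrow> 'h) \<Rightarrow> ('h \<Rightarrow> 'h \<Rightarrow> complex) \<Rightarrow> ('h \<Rightarrow> 'h) monoid" where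
  "unitary_group smul cinner =
    \<lparr>carrier = {U \<in> operators smul. bij U \<and> (\<forall>x y. cinner (U x) (U y) = cinner x y)},
     monoid.mult = (\<circ>), one = id\<rparr>"

definition conj_transpose :: "complex^'n^'m \<Rightarrow> complex^'m^'n" where
  "conj_transpose A = (\<chi> i j. cnj (A $ j $ i))"

text \<open>The special unitary group of degree \<open>d = CARD('d)\<close>.\<close>

definition SU :: "(complex^'d^'d) monoid" where
  "SU = \<lparr>carrier = {A. conj_transpose A ** A = mat 1 \<and> A ** conj_transpose A = mat 1 \<and> det A = 1},
         monoid.mult = (**), one = mat 1\<rparr>"

definition conj_action :: "('h \<Rightarrow> 'h \<Rightarrow> complex) \<Rightarrow> ('h \<Rightarrow> 'h) \<Rightarrow> ('h \<Rightarrow> 'h) \<Rightarrow> 'h \<Rightarrow> 'h" where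
  "conj_action cinner U S = op_adjoint cinner U \<circ> S \<circ> U"

text \<open>The sum of operators is the pointwise sum of functions.\<close>

definition twirl ::
  "(complex \<Rightarrow> 'h::ab_group_add \<Rightarrow> 'h) \<Rightarrow> (complex^'d^'d \<Rightarrow> 'h \<Rightarrow> 'h) \<Rightarrow> (complex^'d^'d) set
    \<Rightarrow> ('h \<Rightarrow> 'h) \<Rightarrow> 'h \<Rightarrow> 'h" where
  "twirl smul \<pi> G S =
    op_scale smul (1 / of_nat (card G)) (\<Sum>g\<in>G. \<pi> (inv\<^bsub>SU\<^esub> g) \<circ> S \<circ> \<pi> g)"

definition invariant_subspace ::
  "('h \<Rightarrow> 'h \<Rightarrow> complex) \<Rightarrow> (complex^'d^'d \<Rightarrow> 'h \<Rightarrow> 'h) \<Rightarrow> (complex^'d^'d) set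
    \<Rightarrow> ('h \<Rightarrow> 'h) set \<Rightarrow> ('h \<Rightarrow> 'h) set" where
  "invariant_subspace cinner \<pi> G V = {S \<in> V. \<forall>g\<in>G. conj_action cinner (\<pi> g) S = S}"

text \<open>Meant for subspaces \<open>V\<close> closed under conjugation by the \<open>\<pi> g\<close>, \<open>g \<in> G\<close>; closure is not
  part of the definition.\<close>

definition inaccessible_symmetry ::
  "(complex \<Rightarrow> 'h::ab_group_add \<Rightarrow> 'h) \<Rightarrow> ('h \<Rightarrow> 'h \<Rightarrow> complex) \<Rightarrow> (complex^'d^'d \<Rightarrow> 'h \<Rightarrow> 'h)
    \<Rightarrow> (complex^'d^'d) set \<Rightarrow> ('h \<Rightarrow> 'h) set \<Rightarrow> bool" where
  "inaccessible_symmetry smul cinner \<pi> G V \<longleftrightarrow>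
    invariant_subspace cinner \<pi> G V = {0} \<or>
    invariant_subspace cinner \<pi> G V = module.span (op_scale smul) {id}"

definition decoupling_group ::
  "(complex \<Rightarrow> 'h::ab_group_add \<Rightarrow> 'h) \<Rightarrow> (complex^'d^'d \<Rightarrow> 'h \<Rightarrow> 'h) \<Rightarrow> (complex^'d^'d) set
    \<Rightarrow> ('h \<Rightarrow> 'h) set \<Rightarrow> bool" where
  "decoupling_group smul \<pi> G I\<^sub>S \<longleftrightarrow>
    twirl smul \<pi> G ` I\<^sub>S = {0} \<or>
    twirl smul \<pi> G ` I\<^sub>S = module.span (op_scale smul) {id}"

lemma vector_space_op_scale:
  assumes "vector_space smul"
  shows "vector_space (op_scale smul)"
proof -
  interpret vector_space smul by fact
  show ?thesis
    by unfold_locales (auto simp: op_scale_def fun_eq_iff scale_right_distrib scale_left_distrib)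
qed

lemma conj_transpose_mult:
  fixes A :: "complex^'n^'m" and B :: "complex^'k^'n"
  shows "conj_transpose (A ** B) = conj_transpose B ** conj_transpose A"
  by (simp add: conj_transpose_def matrix_matrix_mult_def vec_eq_iff mult.commute)

lemma conj_transpose_conj_transpose [simp]: "conj_transpose (conj_transpose A) = A"
  by (simp add: conj_transpose_def vec_eq_iff)

lemma conj_transpose_mat_1 [simp]: "conj_transpose (mat 1) = mat 1"
  by (simp add: conj_transpose_def mat_def vec_eq_iff)

lemma det_conj_transpose:
  fixes A :: "complex^'n^'n"
  shows "det (conj_transpose A) = cnj (det A)"
proof -
  have "conj_transpose A = transpose (\<chi> i j. cnj (A $ i $ j))"
    by (simp add: conj_transpose_def transpose_def)
  then have "det (conj_transpose A) = det ((\<chi> i j. cnj (A $ i $ j)) :: complex^'n^'n)"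
    by (simp add: det_transpose)
  also have "\<dots> = cnj (det A)"
    by (simp add: det_def)
  finally show ?thesis .
qed

lemma group_SU: "group (SU :: (complex^'d^'d) monoid)"
proof (rule groupI)
  fix A B :: "complex^'d^'d"
  assume A: "A \<in> carrier SU" and B: "B \<in> carrier SU"
  have "conj_transpose B ** conj_transpose A ** (A ** B) = mat 1"
    using A B unfolding SU_def
    by simp (metis matrix_mul_assoc matrix_mul_lid)
  moreover have "A ** B ** (conj_transpose B ** conj_transpose A) = mat 1"
    using A B unfolding SU_def
    by simp (metis matrix_mul_assoc matrix_mul_lid)
  ultimately show "A \<otimes>\<^bsub>SU\<^esub> B \<in> carrier SU"
    using A B by (simp add: SU_def conj_transpose_mult det_mul)
next
  fix A :: "complex^'d^'d"
  assume "A \<in> carrier SU"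
  then show "\<exists>B\<in>carrier SU. B \<otimes>\<^bsub>SU\<^esub> A = \<one>\<^bsub>SU\<^esub>"
    by (intro bexI[of _ "conj_transpose A"]) (simp_all add: SU_def det_conj_transpose)
qed (simp_all add: SU_def matrix_mul_assoc)

lemma (in fin_dim_hilbert_space) op_adjoint_unitary:
  assumes "U \<in> carrier (unitary_group smul cinner)"
  shows "op_adjoint cinner U = inv_into UNIV U"
proof -
  have U: "bij U" "\<And>x y. cinner (U x) (U y) = cinner x y"
    using assms by (auto simp: unitary_group_def)
  have eq: "x = y" if "\<And>z. cinner x z = cinner y z" for x y
  proof (rule ccontr)
    assume "x \<noteq> y"
    have "cinner z (x - y) = 0" for z
      using cinner_add_right[of z y "x - y"] that[of z] cinner_commute[of z x] cinner_commute[of z y]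
      by simp
    then show False
      using cinner_pos[of "x - y"] \<open>x \<noteq> y\<close> by simp
  qed
  have *: "\<forall>x y. cinner (inv_into UNIV U x) y = cinner x (U y)"
    using U by (metis bij_inv_eq_iff)
  show ?thesis
    unfolding op_adjoint_def
  proof (rule the_equality)
    show "\<forall>x y. cinner (inv_into UNIV U x) y = cinner x (U y)"
      by (fact *)
  next
    fix T assume T: "\<forall>x y. cinner (T x) y = cinner x (U y)"
    then show "T = inv_into UNIV U"
      using * by (intro ext eq) metis
  qed
qed

end

(* Averaging over \<open>G\<close> maps \<open>I\<^sub>S\<close> into the \<open>G\<close>-invariant part of \<open>V\<close>, which is \<open>{0}\<close> or the
   line spanned by the identity. Since the average is homogeneous, the image of a subspace that lands
   in a line is \<open>{0}\<close> or the whole line. *)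
theory Submission
  imports Defs
begin

lemma sum_fun_apply: "(\<Sum>i\<in>A. f i) x = (\<Sum>i\<in>A. f i x)"
  by (induction A rule: infinite_finite_induct) simp_all

text \<open>Multiplicativity makes \<open>\<pi>\<close> of the unit an idempotent bijection.
  Cancelling one factor shows that it is \<open>id\<close>, and multiplicativity for the inverse of
  \<open>g\<close> and \<open>g\<close> gives the claim.\<close>

lemma unitary_hom_inv:
  assumes "\<pi> \<in> hom SU (unitary_group smul cinner)" and "g \<in> carrier SU"
  shows "\<pi> (inv\<^bsub>SU\<^esub> g) \<circ> \<pi> g = id"
proof -
  interpret SU: group SU by (rule group_SU)
  have mult: "\<pi> (a \<otimes>\<^bsub>SU\<^esub> b) = \<pi> a \<circ> \<pi> b" if "a \<in> carrier SU" "b \<in> carrier SU" for a b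
    using hom_mult[OF assms(1) that] by (simp add: unitary_group_def)
  have "bij (\<pi> \<one>\<^bsub>SU\<^esub>)"
    using hom_in_carrier[OF assms(1) SU.one_closed] by (simp add: unitary_group_def)
  moreover have "\<pi> \<one>\<^bsub>SU\<^esub> \<circ> \<pi> \<one>\<^bsub>SU\<^esub> = \<pi> \<one>\<^bsub>SU\<^esub>"
    using mult[of "\<one>\<^bsub>SU\<^esub>" "\<one>\<^bsub>SU\<^esub>"] by simp
  ultimately have "\<pi> \<one>\<^bsub>SU\<^esub> = id"
    by (metis bij_is_inj inv_o_cancel comp_assoc id_comp)
  then show ?thesis
    using mult[of "inv\<^bsub>SU\<^esub> g" g] assms(2) by simp
qed

text \<open>The adjoint of a unitary operator is its inverse, and the inverse of
  \<open>\<pi> g\<close> is \<open>\<pi>\<close> of the inverse of \<open>g\<close>. This identifies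
  the action that defines invariance with the summands of \<open>twirl\<close>.\<close>

lemma (in fin_dim_hilbert_space) conj_action_unitary_hom:
  assumes "\<pi> \<in> hom SU (unitary_group smul cinner)" and "g \<in> carrier SU"
  shows "conj_action cinner (\<pi> g) S = \<pi> (inv\<^bsub>SU\<^esub> g) \<circ> S \<circ> \<pi> g"
proof -
  have U: "\<pi> g \<in> carrier (unitary_group smul cinner)"
    using hom_in_carrier[OF assms] .
  then have "bij (\<pi> g)" by (simp add: unitary_group_def)
  \<comment> \<open>A left inverse of a bijection is its inverse: evaluate the left-inverse identity
    at the preimage of \<open>x\<close>.\<close>
  then have "inv_into UNIV (\<pi> g) x = \<pi> (inv\<^bsub>SU\<^esub> g) x" for x
    using fun_cong[OF unitary_hom_inv[OF assms], of "inv_into UNIV (\<pi> g) x"]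
    by (simp add: bij_is_surj surj_f_inv_f)
  then show ?thesis
    by (simp add: conj_action_def op_adjoint_unitary[OF U] fun_eq_iff)
qed

text \<open>In each summand the scalar enters after \<open>S\<close> is applied, so linearity of the
  outer factor, \<open>\<pi>\<close> of the inverse of \<open>g\<close>, carries it out of the
  sum.\<close>

lemma (in fin_dim_hilbert_space) twirl_scale:
  assumes "\<pi> \<in> hom SU (unitary_group smul cinner)" and "G \<subseteq> carrier SU"
  shows "twirl smul \<pi> G (op_scale smul k S) = op_scale smul k (twirl smul \<pi> G S)"
proof
  fix x
  interpret SU: group SU by (rule group_SU)
  have "\<pi> (inv\<^bsub>SU\<^esub> g) (smul k y) = smul k (\<pi> (inv\<^bsub>SU\<^esub> g) y)" if "g \<in> G" for g y
  proof -
    have "Vector_Spaces.linear smul smul (\<pi> (inv\<^bsub>SU\<^esub> g))"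
      using hom_in_carrier[OF assms(1), of "inv\<^bsub>SU\<^esub> g"] that assms(2)
      by (auto simp: unitary_group_def operators_def)
    then interpret L: Vector_Spaces.linear smul smul "\<pi> (inv\<^bsub>SU\<^esub> g)" .
    show ?thesis by (rule L.scale)
  qed
  then show "twirl smul \<pi> G (op_scale smul k S) x = op_scale smul k (twirl smul \<pi> G S) x"
    by (simp add: twirl_def op_scale_def sum_fun_apply scale_sum_right mult.commute)
qed

text \<open>Each summand is a conjugate of \<open>S\<close> and lies in \<open>V\<close>, hence so
  does the average. Conjugating the average by \<open>\<pi> h\<close> only permutes the summands,
  since right multiplication by \<open>h\<close> permutes \<open>G\<close>.\<close>

lemma (in fin_dim_hilbert_space) twirl_in_invariant_subspace:
  assumes hom: "\<pi> \<in> hom SU (unitary_group smul cinner)" and G: "subgroup G SU"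
    and V: "module.subspace (op_scale smul) V"
    and closed: "\<And>S g. S \<in> V \<Longrightarrow> g \<in> G \<Longrightarrow> conj_action cinner (\<pi> g) S \<in> V"
    and S: "S \<in> V"
  shows "twirl smul \<pi> G S \<in> invariant_subspace cinner \<pi> G V"
proof -
  interpret SU: group SU by (rule group_SU)
  interpret ops: vector_space "op_scale smul"
    by (rule vector_space_op_scale) (fact vector_space_axioms)
  note conj = conj_action_unitary_hom[OF hom]
  have GSU: "g \<in> carrier SU" if "g \<in> G" for g
    using subgroup.mem_carrier[OF G that] .
  have "\<pi> (inv\<^bsub>SU\<^esub> g) \<circ> S \<circ> \<pi> g \<in> V" if "g \<in> G" for g
    using closed[OF S that] by (simp only: conj[OF GSU[OF that]])
  then have "twirl smul \<pi> G S \<in> V"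
    unfolding twirl_def by (intro ops.subspace_scale[OF V] ops.subspace_sum[OF V])
  moreover have "conj_action cinner (\<pi> h) (twirl smul \<pi> G S) = twirl smul \<pi> G S" if h: "h \<in> G" for h
  proof
    fix x
    have mult: "\<pi> (a \<otimes>\<^bsub>SU\<^esub> b) = \<pi> a \<circ> \<pi> b" if "a \<in> carrier SU" "b \<in> carrier SU" for a b
      using hom_mult[OF hom that] by (simp add: unitary_group_def)
    have "Vector_Spaces.linear smul smul (\<pi> (inv\<^bsub>SU\<^esub> h))"
      using hom_in_carrier[OF hom, of "inv\<^bsub>SU\<^esub> h"] GSU[OF h]
      by (auto simp: unitary_group_def operators_def)
    then interpret L: Vector_Spaces.linear smul smul "\<pi> (inv\<^bsub>SU\<^esub> h)" .
    let ?F = "\<lambda>g. \<pi> (inv\<^bsub>SU\<^esub> g) (S (\<pi> g x))"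
    \<comment> \<open>The inverse of a product reverses the factors, so conjugating by
      \<open>g\<close> and then by \<open>h\<close> is conjugating by the product of
      \<open>g\<close> and \<open>h\<close>.\<close>
    have "\<pi> (inv\<^bsub>SU\<^esub> h) (\<pi> (inv\<^bsub>SU\<^esub> g) (S (\<pi> g (\<pi> h x)))) = ?F (g \<otimes>\<^bsub>SU\<^esub> h)" if "g \<in> G" for g
      using GSU[OF h] GSU[OF that] by (simp add: SU.inv_mult_group mult)
    then have "conj_action cinner (\<pi> h) (twirl smul \<pi> G S) x
        = smul (1 / of_nat (card G)) (\<Sum>g\<in>G. ?F (g \<otimes>\<^bsub>SU\<^esub> h))"
      by (simp add: conj[OF GSU[OF h]] twirl_def op_scale_def sum_fun_apply L.scale L.sum)
    also have "(\<Sum>g\<in>G. ?F (g \<otimes>\<^bsub>SU\<^esub> h)) = (\<Sum>g\<in>G. ?F g)"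
      by (rule sum.reindex_bij_witness[of _ "\<lambda>g. g \<otimes>\<^bsub>SU\<^esub> inv\<^bsub>SU\<^esub> h" "\<lambda>g. g \<otimes>\<^bsub>SU\<^esub> h"])
        (use h GSU in \<open>auto simp: SU.m_assoc subgroup.m_closed[OF G] subgroup.m_inv_closed[OF G]\<close>)
    also have "smul (1 / of_nat (card G)) \<dots> = twirl smul \<pi> G S x"
      by (simp add: twirl_def op_scale_def sum_fun_apply)
    finally show "conj_action cinner (\<pi> h) (twirl smul \<pi> G S) x = twirl smul \<pi> G S x" .
  qed
  ultimately show ?thesis by (simp add: invariant_subspace_def)
qed

text \<open>A single nonzero value of \<open>f\<close> on the line can be rescaled to every point of
  the line, and \<open>I\<close> contains all multiples of the argument where it is
  attained.\<close>

lemma (in vector_space) homogeneous_image_in_line: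
  assumes I: "subspace I" and hom: "\<And>c x. x \<in> I \<Longrightarrow> f (scale c x) = scale c (f x)"
    and line: "f ` I \<subseteq> span {v}"
  shows "f ` I = {0} \<or> f ` I = span {v}"
proof (cases "f ` I \<subseteq> {0}")
  case True
  \<comment> \<open>Rules out the empty set as the other subset of \<open>{0}\<close>.\<close>
  moreover have "f ` I \<noteq> {}" using subspace_0[OF I] by auto
  ultimately show ?thesis by (simp add: subset_singleton_iff)
next
  case False
  then obtain x where x: "x \<in> I" "f x \<noteq> 0" by blast
  from x(1) line have "f x \<in> span {v}" by auto
  then obtain c where c: "f x = scale c v" unfolding span_singleton by auto
  have "scale k v \<in> f ` I" for k
  proof
    have "c \<noteq> 0" using x(2) c by auto
    \<comment> \<open>Since \<open>f x\<close> is \<open>c\<close> times \<open>v\<close>, scaling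
      \<open>x\<close> by \<open>k / c\<close> turns the coefficient \<open>c\<close> into
      \<open>k\<close>.\<close>
    then show "scale k v = f (scale (k / c) x)" by (simp add: hom[OF x(1)] c)
    show "scale (k / c) x \<in> I" using subspace_scale[OF I x(1)] .
  qed
  then have "span {v} \<subseteq> f ` I" unfolding span_singleton by (rule image_subsetI)
  with line show ?thesis by (intro disjI2 equalityI)
qed

theorem lemma2:
  fixes smul :: "complex \<Rightarrow> 'h::ab_group_add \<Rightarrow> 'h"
    and cinner :: "'h \<Rightarrow> 'h \<Rightarrow> complex"
    and \<pi> :: "complex^'d^'d \<Rightarrow> 'h \<Rightarrow> 'h"
    and G :: "(complex^'d^'d) set"
    and I\<^sub>S V :: "('h \<Rightarrow> 'h) set"
  assumes "fin_dim_hilbert_space smul cinner"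
    and "\<pi> \<in> hom SU (unitary_group smul cinner)"
    and "module.subspace (op_scale smul) I\<^sub>S" and "I\<^sub>S \<subseteq> operators smul"
    and "subgroup G SU" and "finite G"
    and "module.subspace (op_scale smul) V" and "I\<^sub>S \<subseteq> V" and "V \<subseteq> operators smul"
    and "\<forall>S\<in>V. \<forall>g\<in>G. conj_action cinner (\<pi> g) S \<in> V"
    and "inaccessible_symmetry smul cinner \<pi> G V"
  shows "decoupling_group smul \<pi> G I\<^sub>S"
proof -
  interpret fin_dim_hilbert_space smul cinner by fact
  interpret ops: vector_space "op_scale smul"
    by (rule vector_space_op_scale) (fact vector_space_axioms)
  have "twirl smul \<pi> G ` I\<^sub>S \<subseteq> invariant_subspace cinner \<pi> G V"
    using twirl_in_invariant_subspace[OF assms(2,5,7)] assms(8,10) by blast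
  \<comment> \<open>Both alternatives of inaccessibility lie in the line through \<open>id\<close>,
    so no case split is carried further. Which alternative holds for the image is decided afresh by
    homogeneity: the image may be \<open>{0}\<close> even when the invariant subspace is the whole
    line.\<close>
  also have "\<dots> \<subseteq> ops.span {id}"
    using assms(11) ops.span_zero by (auto simp: inaccessible_symmetry_def)
  finally show ?thesis
    unfolding decoupling_group_def
    by (intro ops.homogeneous_image_in_line assms(3) twirl_scale[OF assms(2)]
        subgroup.subset[OF assms(5)])
qed

end
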